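(* Let $Y_\star\in\mathcal M_1$ with $E_\star=\Pi^{\mathcal S}Y_\star\in\mathcal S$ of unit Frobenius norm. Let $Y_\star$ be a stationary point of the rank-1 projected differential equation $$\dot Y=-P_YG_\varepsilon(E)+\operatorname{Re}\langle P_YG_\varepsilon(E),E\rangle\,Y\quad\text{with } E=\Pi^{\mathcal S}Y \text{ of unit Frobenius norm},$$ with an associated target eigenvalue $\lambda$ of $A+\varepsilon E_\star$ that is simple. Let $\delta$ be a sufficiently small positive number. Then, there exists $\bar\delta>0$ such that for all positive $\delta\le\bar\delta$ and all $Y\in\mathcal M_1$ with $\|Y-Y_\star\|\le\delta$ and $E(Y)=\Pi^{\mathcal S}Y$ of unit norm, we have $$\|P_YG_\varepsilon(E(Y))-G_\varepsilon(E(Y))\|\le C\delta^2$$ with $C$ independent of $\delta$.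
   Context: $A\in\mathbb{C}^{n\times n}$ is given, $\varepsilon>0$, and $\mathcal S$ is a (real- or complex-linear) subspace of $\mathbb{C}^{n\times n}$. $\langle X,Y\rangle=\operatorname{tr}(X^*Y)$; norms of matrices are Frobenius norms. $\Pi^{\mathcal S}$ is the orthogonal projection onto $\mathcal S$ with respect to $\operatorname{Re}\langle\cdot,\cdot\rangle$. $\lambda(M)$ denotes a chosen target eigenvalue of a matrix $M$ (e.g. an eigenvalue of largest real part, or of largest or smallest modulus); near a matrix $E$ where the target eigenvalue of $A+\varepsilon E$ is simple, it is taken to depend continuously on $E$ (and so remains simple). $f:\mathbb{C}^2\to\mathbb{C}$ is smooth with $f(z,\overline z)=f(\overline z,z)\in\mathbb{R}$ for all $z\in\mathbb{C}$. With $\lambda=\lambda(A+\varepsilon E)$ simple, let $x,y$ be left and right eigenvectors of $A+\varepsilon E$ for $\lambda$ (i.e. $x^*(A+\varepsilon E)=\lambda x^*$, $(A+\varepsilon E)y=\lambda y$) normalized by $\|x\|=\|y\|=1$ and $x^*y>0$; set $G_\varepsilon(E)=2f_{\overline\lambda}\,xy^*$ with $f_{\overline\lambda}=\frac{\partial f}{\partial\overline\lambda}(\lambda,\overline\lambda)$ (the Wirtinger derivative of $z\mapsto f(z,\overline z)$ with respect to $\overline z$), which does not depend on the choice of normalized eigenvectors. $\mathcal M_1$ is the manifold of complex $n\times n$ matrices of rank $1$. For $Y=\sigma uv^*\in\mathcal M_1$ with $\|u\|=\|v\|=1$, $P_Y$ is the orthogonal projection onto the tangent space $T_Y\mathcal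 M_1$, given by $P_Y(Z)=Z-(I-uu^* )Z(I-vv^* )$. A stationary point of a differential equation is a point where its right-hand side vanishes.
   Formalization: The formal theorem additionally assumes that the projected gradient P_Y G_ε(E) is nonzero at the stationary point Y⋆; without it the claim fails, e.g. A=diag(1,0), ε=1/2, S all 2×2 matrices, f=−Re λ, rightmost eigenvalue, Y⋆=diag(0,1). *)

theory Defs
  imports "HOL-Analysis.Analysis" "HOL-Computational_Algebra.Polynomial"
begin

text \<open>
  Matrices are elements of \<open>complex^'n^'n\<close>. On this type \<open>norm\<close> is the Frobenius norm, and
  \<open>subspace\<close> means real-linear subspace; every complex-linear subspace is one.
\<close>

subsection \<open>Vectors and matrices\<close>

definition cinner :: "complex^'n \<Rightarrow> complex^'n \<Rightarrow> complex" where
  "cinner x y = (\<Sum>i\<in>UNIV. cnj (x $ i) * y $ i)"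

definition vconj :: "complex^'n \<Rightarrow> complex^'n" where
  "vconj x = (\<chi> i. cnj (x $ i))"

definition ctranspose :: "complex^'n^'n \<Rightarrow> complex^'n^'n" where
  "ctranspose M = (\<chi> i j. cnj (M $ j $ i))"

definition finner :: "complex^'n^'n \<Rightarrow> complex^'n^'n \<Rightarrow> complex" where
  "finner X Y = trace (ctranspose X ** Y)"

definition cscale :: "complex \<Rightarrow> complex^'n^'n \<Rightarrow> complex^'n^'n" where
  "cscale c M = map_matrix ((*) c) M"

text \<open>\<open>outer x y\<close> is the matrix $x y^*$.\<close>

definition outer :: "complex^'n \<Rightarrow> complex^'n \<Rightarrow> complex^'n^'n" where
  "outer x y = (\<chi> i j. x $ i * cnj (y $ j))"

lemma Re_finner_eq_inner: "Re (finner X Y) = X \<bullet> Y"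
proof -
  have "Re (finner X Y) = (\<Sum>i\<in>UNIV. \<Sum>k\<in>UNIV. X$k$i \<bullet> Y$k$i)"
    by (simp add: finner_def trace_def matrix_matrix_mult_def ctranspose_def inner_complex_def)
  also have "\<dots> = (\<Sum>k\<in>UNIV. \<Sum>i\<in>UNIV. X$k$i \<bullet> Y$k$i)"
    by (rule sum.swap)
  finally show ?thesis
    by (simp add: inner_vec_def)
qed

subsection \<open>Orthogonal projection onto the structure space\<close>

definition orth_proj :: "(complex^'n^'n) set \<Rightarrow> complex^'n^'n \<Rightarrow> complex^'n^'n" where
  "orth_proj S Y = (THE E. E \<in> S \<and> (\<forall>Z\<in>S. Re (finner (Y - E) Z) = 0))"

lemma orth_proj_eqI:
  assumes "subspace S" "E \<in> S" "\<And>Z. Z \<in> S \<Longrightarrow> Re (finner (Y - E) Z) = 0"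
  shows "orth_proj S Y = E"
  unfolding orth_proj_def
proof (rule the_equality)
  fix E' assume E': "E' \<in> S \<and> (\<forall>Z\<in>S. Re (finner (Y - E') Z) = 0)"
  have D: "E - E' \<in> S"
    using assms E' by (simp add: subspace_diff)
  have "(Y - E') \<bullet> (E - E') = 0" "(Y - E) \<bullet> (E - E') = 0"
    using E' assms D by (auto simp flip: Re_finner_eq_inner)
  then have "(E - E') \<bullet> (E - E') = 0"
    by (simp add: inner_diff_left)
  then show "E' = E"
    by simp
qed (use assms in auto)

lemma orth_proj_exists:
  assumes "subspace S"
  shows "\<exists>E\<in>S. \<forall>Z\<in>S. Re (finner (Y - E) Z) = 0"
proof -
  have "span S = S"
    using assms by (simp add: span_eq_iff)
  then show ?thesis
    by (metis orthogonal_subspace_decomp_exists[of S Y] orthogonal_def Re_finner_eq_inner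
        add_diff_cancel_left')
qed

subsection \<open>Simple eigenvalues\<close>

definition charpoly :: "complex^'n^'n \<Rightarrow> complex poly" where
  "charpoly M = det (mat [:0, 1:] - map_matrix (\<lambda>c. [:c:]) M)"

definition eigval :: "complex^'n^'n \<Rightarrow> complex \<Rightarrow> bool" where
  "eigval M l \<longleftrightarrow> (\<exists>v. v \<noteq> 0 \<and> M *v v = l *s v)"

definition simple_eigval :: "complex^'n^'n \<Rightarrow> complex \<Rightarrow> bool" where
  "simple_eigval M l \<longleftrightarrow> eigval M l \<and> order l (charpoly M) = 1"

definition eigpair :: "complex^'n^'n \<Rightarrow> complex \<Rightarrow> complex^'n \<Rightarrow> complex^'n \<Rightarrow> bool" where
  "eigpair M l x y \<longleftrightarrow>
     vconj x v* M = l *s vconj x \<and> M *v y = l *s y \<and>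
     norm x = 1 \<and> norm y = 1 \<and> cinner x y \<in> \<real> \<and> Re (cinner x y) > 0"

subsection \<open>Smooth functions and the Wirtinger derivative\<close>

fun Ck :: "nat \<Rightarrow> (complex \<times> complex \<Rightarrow> complex) \<Rightarrow> bool" where
  "Ck 0 g \<longleftrightarrow> continuous_on UNIV g"
| "Ck (Suc k) g \<longleftrightarrow>
     (\<forall>p. g differentiable at p) \<and> (\<forall>h. Ck k (\<lambda>p. frechet_derivative g (at p) h))"

text \<open>Smoothness is in the real sense; \<open>f\<close> is not required to be holomorphic.\<close>

definition smooth :: "(complex \<times> complex \<Rightarrow> complex) \<Rightarrow> bool" where
  "smooth f \<longleftrightarrow> (\<forall>k. Ck k f)"

text \<open>$\partial F / \partial\overline{z} = \frac12 (\partial_x F + \mathrm{i}\,\partial_y F)$ for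
  $z = x + \mathrm{i} y$.\<close>

definition wirtinger_bar :: "(complex \<Rightarrow> complex) \<Rightarrow> complex \<Rightarrow> complex" where
  "wirtinger_bar F z =
     (frechet_derivative F (at z) 1 + \<i> * frechet_derivative F (at z) \<i>) / 2"

subsection \<open>The gradient and the rank-1 projected differential equation\<close>

text \<open>
  \<open>lam M\<close> is the target eigenvalue of \<open>M\<close>. If it is simple, the matrix below
  is independent of the choice of the normalized eigenvectors.
\<close>

definition grad ::
  "complex^'n^'n \<Rightarrow> real \<Rightarrow> (complex \<times> complex \<Rightarrow> complex) \<Rightarrow> (complex^'n^'n \<Rightarrow> complex)
    \<Rightarrow> complex^'n^'n \<Rightarrow> complex^'n^'n" where
  "grad A \<epsilon> f lam E =
     (let M = A + \<epsilon> *\<^sub>R E; l = lam M in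
      THE G. \<exists>x y. eigpair M l x y \<and>
        G = cscale (2 * wirtinger_bar (\<lambda>z. f (z, cnj z)) l) (outer x y))"

definition rank1 :: "(complex^'n^'n) set" where
  "rank1 = {Y. rank Y = 1}"

text \<open>
  \<open>tproj Y\<close> is $P_Y$ for \<open>Y\<close> of rank 1. It depends on \<open>u\<close> and \<open>v\<close> only through $uu^*$ and $vv^*$,
  hence only on \<open>Y\<close>.
\<close>

definition tproj :: "complex^'n^'n \<Rightarrow> complex^'n^'n \<Rightarrow> complex^'n^'n" where
  "tproj Y Z =
     (THE W. \<exists>\<sigma> u v. norm u = 1 \<and> norm v = 1 \<and> Y = cscale \<sigma> (outer u v) \<and>
        W = Z - (mat 1 - outer u u) ** Z ** (mat 1 - outer v v))"

text \<open>
  At a stationary point with $P_Y G_\varepsilon(E) \neq 0$ the matrix $G_\varepsilon(E)$ is a multiple of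
  $Y$. Stationary points with $P_Y G_\varepsilon(E) = 0 \neq G_\varepsilon(E)$ also exist: take
  $A = \mathrm{diag}(1,0)$, $\varepsilon = 1/2$, all $2 \times 2$ matrices as structure space,
  $f(a,b) = -(a+b)/2$, the eigenvalue of largest real part, and $Y = \mathrm{diag}(0,1)$.
\<close>

definition rank1_rhs ::
  "(complex^'n^'n) set \<Rightarrow> complex^'n^'n \<Rightarrow> real \<Rightarrow> (complex \<times> complex \<Rightarrow> complex)
    \<Rightarrow> (complex^'n^'n \<Rightarrow> complex) \<Rightarrow> complex^'n^'n \<Rightarrow> complex^'n^'n" where
  "rank1_rhs S A \<epsilon> f lam Y =
     (let E = orth_proj S Y; PG = tproj Y (grad A \<epsilon> f lam E) in
      - PG + Re (finner PG E) *\<^sub>R Y)"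

end

theory Submission
  imports Defs
begin

text \<open>
  At the stationary point $P_Y G$ is a nonzero real multiple $\nu Y$ of $Y = \sigma u v^*$. Comparing
  $Gv$ and $u^*G$ for the rank-1 matrix $G$ with those of $\nu Y$ shows that $G_\varepsilon(E_\star)
  = \nu Y_\star$ itself. For nearby $Y = \sigma uv^*$ and $G = ab^*$, the defect $(I-uu^*)\,G\,(I-vv^*)$ has norm
  $\|(I-uu^*)a\|\,\|(I-vv^*)b\|$; since $(I-uu^*)G = (I-uu^*)(G-\nu Y)$, and symmetrically on the other side,
  both factors are of the order of $\|G - \nu Y\|$, hence of $\delta$, once $G_\varepsilon$ is Lipschitz at $E_\star$.
  This Lipschitz estimate is obtained from bordered linear systems for the eigenvectors instead of
  the analytic perturbation theory of simple eigenvalues.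
\<close>

subsection \<open>Simple eigenvalues\<close>

text \<open>The assumption that \<open>P_Y G\<close> is nonzero at the stationary point carries the
  estimate: if it vanished while \<open>G\<close> did not, the choice \<open>Y = Ystar\<close> would
  give the defect \<open>norm (G Estar)\<close> for every \<delta>. It also keeps
  \<open>norm (G E)\<close> away from 0 near \<open>Estar\<close>, so that one can divide by it.
  Three obstacles shape the Lipschitz estimate. Simplicity is given as the order of a root of the
  characteristic polynomial, whereas the proof needs one-dimensional eigenspaces and
  \<open>cinner x y \<noteq> 0\<close>; excluding Jordan chains bridges this gap. Normalized
  eigenpairs are determined only up to a common unit factor; eigenvectors are therefore scaled
  linearly against fixed vectors, and the phase of their inner product restores the normalized outer
  product. Finally, the target eigenvalue is only known to be continuous: this keeps the bordered
  systems injective, and pairing with the left eigenvector at \<open>Estar\<close> then improves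
  continuity to a Lipschitz bound.\<close>

lemma det_jordan_rows:
  fixes B Q :: "'a::comm_ring_1^'n^'n"
  assumes "i \<noteq> j" "B $ i = s *s Q $ i" "B $ j = s *s Q $ j + c *s Q $ i"
  shows "s\<^sup>2 dvd det B"
proof -
  define B1 where "B1 = (\<chi> k. if k = i then Q $ i else B $ k)"
  have "det B = det (\<chi> k. if k = i then s *s Q $ k else B $ k)"
    using assms(2) by (intro arg_cong[where f = det]) (auto simp: vec_eq_iff)
  also have "\<dots> = s * det B1"
    unfolding B1_def det_row_mul by (intro arg_cong[where f = "\<lambda>D. s * det D"]) (auto simp: vec_eq_iff)
  \<comment> \<open>Once a factor \<open>s\<close> has left row \<open>i\<close>, that row is
    \<open>Q $ i\<close>; subtracting \<open>c\<close> times it reduces row \<open>j\<close> to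
    \<open>s *s Q $ j\<close>, which releases the second factor.\<close>
  also have "det B1 = det (\<chi> k. if k = j then row j B1 + (- c) *s row i B1 else row k B1)"
    using assms(1) by (intro det_row_operation[symmetric]) auto
  also have "\<dots> = det (\<chi> k. if k = j then s *s Q $ k else B1 $ k)"
    using assms by (intro arg_cong[where f = det]) (auto simp: vec_eq_iff row_def B1_def)
  also have "\<dots> = s * det (\<chi> k. if k = j then Q $ k else B1 $ k)"
    by (rule det_row_mul)
  finally show ?thesis
    by (simp add: power2_eq_square flip: mult.assoc)
qed

lemma poly_det:
  fixes A :: "complex poly^'n^'n"
  shows "poly (det A) t = det (map_matrix (\<lambda>p. poly p t) A)"
  by (simp add: det_def map_matrix_def poly_sum poly_prod)

lemma det_nonzero_iff_ker:
  fixes A :: "'a::field^'n^'n"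
  shows "det A \<noteq> 0 \<longleftrightarrow> (\<forall>v. A *v v = 0 \<longrightarrow> v = 0)"
  by (metis invertible_det_nz invertible_left_inverse matrix_left_invertible_ker)

lemma vec_smult_mat_vector: "(mat c :: 'a::comm_ring_1^'n^'n) *v v = c *s v"
  by (simp add: matrix_vector_mult_def mat_def vec_eq_iff if_distrib if_distribR cong: if_cong)

lemma norm_vec_smult [simp]: "norm (c *s (v :: complex^'n)) = norm c * norm v"
  by (simp add: norm_vec_def norm_mult L2_set_right_distrib)

text \<open>Only for nonzero polynomials does \<open>order\<close> measure divisibility by powers
  and add up over products.\<close>

lemma charpoly_nonzero: "charpoly (M :: complex^'n^'n) \<noteq> 0"
proof
  assume 0: "charpoly M = 0"
  obtain B where B: "\<And>v. norm (M *v v) \<le> B * norm v"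
    using linear_bounded[OF matrix_vector_mul_linear[of M]] by blast
  \<comment> \<open>A number beyond the bound \<open>B\<close> of the linear map \<open>M\<close>
    cannot be an eigenvalue.\<close>
  define t where "t = complex_of_real (\<bar>B\<bar> + 1)"
  have "map_matrix (\<lambda>p. poly p t) (mat [:0, 1:] - map_matrix (\<lambda>c. [:c:]) M) = mat t - M"
    by (simp add: map_matrix_def mat_def vec_eq_iff)
  then have "det (mat t - M) = poly (charpoly M) t"
    by (simp add: charpoly_def poly_det)
  then obtain v where v: "(mat t - M) *v v = 0" "v \<noteq> 0"
    using 0 det_nonzero_iff_ker[of "mat t - M"] by auto
  then have "M *v v = t *s v"
    by (simp add: matrix_vector_mult_diff_rdistrib vec_smult_mat_vector)
  then have "(\<bar>B\<bar> + 1) * norm v \<le> B * norm v"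
    using B[of v] unfolding t_def by (metis abs_ge_zero abs_of_nonneg add_nonneg_nonneg norm_of_real norm_vec_smult zero_le_one)
  then show False
    using v by simp
qed

text \<open>The rows \<open>y\<close> and \<open>z\<close>, completed by unit vectors to an invertible matrix \<open>P\<close>, make
  $(X - l)^2$ a divisor of $\det (P (X I - M))$.\<close>

lemma simple_eigval_no_jordan_pair:
  fixes M :: "complex^'n^'n"
  assumes "order l (charpoly M) = 1"
    and y: "y v* M = l *s y" and z: "z v* M = l *s z + c *s y"
    and ij: "i \<noteq> j" and y_i: "y $ i \<noteq> 0" and z_i: "z $ i = 0" and z_j: "z $ j \<noteq> 0"
  shows False
proof -
  define P :: "complex^'n^'n" where
    "P = (\<chi> k. if k = i then y else if k = j then z else axis k 1)"
  define C where "C = (\<lambda>c::complex. [:c:])"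
  define X where "X = mat [:0, 1:] - map_matrix C M"
  \<comment> \<open>The unit rows annihilate all entries of \<open>w\<close> but two; then
    \<open>z\<close>, which vanishes at \<open>i\<close>, annihilates entry \<open>j\<close>, and
    \<open>y\<close> annihilates entry \<open>i\<close>.\<close>
  have "w = 0" if "P *v w = 0" for w
  proof -
    have w: "(\<Sum>m\<in>UNIV. P $ k $ m * w $ m) = 0" for k
      using that by (simp add: matrix_vector_mult_def vec_eq_iff)
    have o: "w $ k = 0" if "k \<noteq> i" "k \<noteq> j" for k
    proof -
      have "(\<Sum>m\<in>UNIV. P $ k $ m * w $ m) = (\<Sum>m\<in>UNIV. if m = k then w $ m else 0)"
        using that by (intro sum.cong) (auto simp: P_def axis_def)
      then show ?thesis
        using w[of k] by simp
    qed
    have "(\<Sum>m\<in>UNIV. z $ m * w $ m) = (\<Sum>m\<in>UNIV. if m = j then z $ j * w $ j else 0)"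
      by (intro sum.cong refl) (metis o z_i mult_zero_left mult_zero_right)
    then have j: "w $ j = 0"
      using w[of j] ij z_j by (simp add: P_def)
    have "(\<Sum>m\<in>UNIV. y $ m * w $ m) = (\<Sum>m\<in>UNIV. if m = i then y $ i * w $ i else 0)"
      by (intro sum.cong refl) (metis o j mult_zero_right)
    then have "w $ i = 0"
      using w[of i] y_i by (simp add: P_def)
    then show ?thesis
      using o j by (metis vec_eq_iff zero_index)
  qed
  then have P: "det P \<noteq> 0"
    unfolding det_nonzero_iff_ker by blast
  \<comment> \<open>Each row of the product is X times a row of \<open>P\<close> minus that row
    applied to \<open>M\<close>, so the chain relations for \<open>y\<close> and \<open>z\<close>
    become relations between polynomial rows.\<close>
  have row: "(map_matrix C P ** X) $ k = (\<chi> m. [:0, 1:] * C (P $ k $ m) - C ((P $ k v* M) $ m))" for k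
  proof -
    have "(map_matrix C P ** X) $ k $ m = [:0, 1:] * C (P $ k $ m) - C ((P $ k v* M) $ m)" for m
    proof -
      have "(map_matrix C P ** X) $ k $ m =
        (\<Sum>r\<in>UNIV. (if r = m then [:0, 1:] * C (P $ k $ r) else 0) - C (P $ k $ r * M $ r $ m))"
        unfolding matrix_matrix_mult_def X_def map_matrix_def mat_def C_def
        by (auto intro!: sum.cong simp: algebra_simps)
      also have "\<dots> = [:0, 1:] * C (P $ k $ m) - (\<Sum>r\<in>UNIV. C (P $ k $ r * M $ r $ m))"
        by (simp add: sum_subtractf)
      also have "(\<Sum>r\<in>UNIV. C (P $ k $ r * M $ r $ m)) = C (\<Sum>r\<in>UNIV. P $ k $ r * M $ r $ m)"
        unfolding C_def by (rule sum_to_poly)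
      finally show ?thesis
        by (simp add: vector_matrix_mult_def mult.commute)
    qed
    then show ?thesis
      by (simp add: vec_eq_iff)
  qed
  have "[:- l, 1:]\<^sup>2 dvd det (map_matrix C P ** X)"
  proof (rule det_jordan_rows[OF ij])
    show "(map_matrix C P ** X) $ i = [:- l, 1:] *s map_matrix C P $ i"
      by (simp add: row) (simp add: P_def y vec_eq_iff C_def map_matrix_def)
    show "(map_matrix C P ** X) $ j = [:- l, 1:] *s map_matrix C P $ j + C (- c) *s map_matrix C P $ i"
      using ij by (simp add: row) (simp add: P_def z vec_eq_iff C_def map_matrix_def)
  qed
  moreover have "det (map_matrix C P ** X) = det (map_matrix C P) * charpoly M"
    by (simp add: det_mul X_def C_def charpoly_def)
  \<comment> \<open>\<open>P\<close> is a constant invertible matrix, so its determinant adds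
    nothing to the order at \<open>l\<close>.\<close>
  moreover have nz: "poly (det (map_matrix C P)) l \<noteq> 0"
  proof -
    have "map_matrix (\<lambda>p. poly p l) (map_matrix C P) = P"
      by (simp add: C_def map_matrix_def vec_eq_iff)
    then show ?thesis
      using P by (simp add: poly_det)
  qed
  ultimately have "2 \<le> order l (det (map_matrix C P) * charpoly M)"
    using charpoly_nonzero[of M] by (auto simp: order_divides)
  also have "\<dots> = order l (charpoly M)"
    using nz charpoly_nonzero[of M] by (subst order_mult) (auto simp: order_root)
  finally show False
    using assms(1) by simp
qed

text \<open>Subtracting the multiple of \<open>y\<close> that clears entry \<open>i\<close> keeps
  the chain relation, and any other nonzero entry is then excluded. The case \<open>c = 0\<close>
  makes the left eigenspace a line; for \<open>c \<noteq> 0\<close> the conclusion forces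
  \<open>c *s y = 0\<close>, so no generalized eigenvector exists.\<close>

lemma simple_eigval_left_chain:
  fixes M :: "complex^'n^'n"
  assumes "order l (charpoly M) = 1"
    and y: "y v* M = l *s y" "y \<noteq> 0" and z: "z v* M = l *s z + c *s y"
  obtains t where "z = t *s y"
proof -
  obtain i where i: "y $ i \<noteq> 0"
    using y(2) by (metis vec_eq_iff zero_index)
  define z' where "z' = z - (z $ i / y $ i) *s y"
  have "z' v* M = l *s z' + c *s y"
    using y z
    by (simp add: z'_def vector_matrix_mult_diff_distrib scalar_vector_matrix_assoc vec_eq_iff algebra_simps)
  moreover have "z' $ i = 0"
    using i by (simp add: z'_def)
  ultimately have "z' $ j = 0" for j
    using simple_eigval_no_jordan_pair[OF assms(1) y(1) _ _ i, of z' c j] by (cases "i = j") auto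
  then have "z' = 0"
    by (simp add: vec_eq_iff)
  then show ?thesis
    using that[of "z $ i / y $ i"] by (simp add: z'_def)
qed

section \<open>Adjoint matrices and the complex inner product\<close>

lemma ctranspose_vector: "ctranspose M *v x = vconj (vconj x v* M)"
  by (simp add: ctranspose_def vconj_def matrix_vector_mult_def vector_matrix_mult_def vec_eq_iff mult.commute)

lemma vconj_vconj [simp]: "vconj (vconj x) = x"
  by (simp add: vconj_def vec_eq_iff)

lemma vconj_smult: "vconj (c *s x) = cnj c *s vconj x"
  by (simp add: vconj_def vec_eq_iff)

text \<open>Left eigenvectors become right eigenvectors of the adjoint, so one perturbation argument
  serves both sides.\<close>

lemma left_eigvec_iff: "vconj x v* M = l *s vconj x \<longleftrightarrow> ctranspose M *v x = cnj l *s x"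
  by (metis ctranspose_vector complex_cnj_cnj vconj_smult vconj_vconj)

lemma ctranspose_ctranspose [simp]: "ctranspose (ctranspose M) = M"
  by (simp add: ctranspose_def vec_eq_iff)

lemma ctranspose_mult: "ctranspose (A ** B) = ctranspose B ** ctranspose A"
  by (simp add: ctranspose_def matrix_matrix_mult_def vec_eq_iff mult.commute)

lemma ctranspose_mat [simp]: "ctranspose (mat c) = mat (cnj c)"
  by (auto simp: ctranspose_def mat_def vec_eq_iff)

lemma ctranspose_diff: "ctranspose (A - B) = ctranspose A - ctranspose B"
  by (simp add: ctranspose_def vec_eq_iff)

lemma ctranspose_add: "ctranspose (A + B) = ctranspose A + ctranspose B"
  by (simp add: ctranspose_def vec_eq_iff)

lemma ctranspose_outer [simp]: "ctranspose (outer a b) = outer b a"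
  by (simp add: ctranspose_def outer_def vec_eq_iff mult.commute)

lemma outer_vector: "outer a b *v z = cinner b z *s a"
  by (simp add: outer_def matrix_vector_mult_def cinner_def vec_eq_iff sum_distrib_left mult_ac)

lemma cinner_ctranspose: "cinner (ctranspose M *v x) z = cinner x (M *v z)"
proof -
  have "cinner (ctranspose M *v x) z = (\<Sum>i\<in>UNIV. \<Sum>j\<in>UNIV. M $ j $ i * cnj (x $ j) * z $ i)"
    by (simp add: cinner_def ctranspose_def matrix_vector_mult_def sum_distrib_right)
  also have "\<dots> = (\<Sum>j\<in>UNIV. \<Sum>i\<in>UNIV. M $ j $ i * cnj (x $ j) * z $ i)"
    by (rule sum.swap)
  finally show ?thesis
    by (simp add: cinner_def matrix_vector_mult_def sum_distrib_left mult_ac)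
qed

lemma cinner_smult_right [simp]: "cinner x (c *s y) = c * cinner x y"
  by (simp add: cinner_def sum_distrib_left mult_ac)

lemma cinner_smult_left [simp]: "cinner (c *s x) y = cnj c * cinner x y"
  by (simp add: cinner_def sum_distrib_left mult_ac)

lemma cinner_diff_right: "cinner x (y - z) = cinner x y - cinner x z"
  by (simp add: cinner_def sum_subtractf algebra_simps)

lemma cnj_cinner: "cnj (cinner x y) = cinner y x"
  by (simp add: cinner_def mult.commute)

lemma cinner_self: "cinner x x = complex_of_real ((norm x)\<^sup>2)"
proof -
  have "cinner x x = (\<Sum>i\<in>UNIV. complex_of_real ((norm (x $ i))\<^sup>2))"
    by (simp add: cinner_def complex_norm_square mult.commute del: of_real_power)
  then show ?thesis
    by (simp add: norm_vec_def L2_set_def sum_nonneg)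
qed

lemma cinner_zero [simp]: "cinner 0 y = 0" "cinner x 0 = 0"
  by (simp_all add: cinner_def)

text \<open>A one-sided inverse of a square matrix is two-sided, and its adjoint inverts the adjoint
  matrix.\<close>

lemma ker_ctranspose:
  fixes K :: "complex^'n^'n"
  assumes "\<And>z. K *v z = 0 \<Longrightarrow> z = 0" "ctranspose K *v z = 0"
  shows "z = 0"
proof -
  have "\<exists>B. B ** K = mat 1"
    using assms(1) by (subst matrix_left_invertible_ker) blast
  then obtain B where "B ** K = mat 1" by blast
  then have "K ** B = mat 1"
    by (simp add: matrix_left_right_inverse)
  then have "ctranspose B ** ctranspose K = mat 1"
    by (metis ctranspose_mult ctranspose_mat complex_cnj_one)
  then show ?thesis
    by (metis assms(2) matrix_vector_mul_assoc matrix_vector_mul_lid matrix_vector_mult_0_right)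
qed

lemma eigval_ctranspose:
  assumes "eigval M l"
  shows "eigval (ctranspose M) (cnj l)"
proof (rule ccontr)
  assume "\<not> eigval (ctranspose M) (cnj l)"
  then have *: "ctranspose (M - mat l) *v z = 0 \<Longrightarrow> z = 0" for z
    by (auto simp: eigval_def ctranspose_diff matrix_vector_mult_diff_rdistrib vec_smult_mat_vector)
  obtain v where v: "v \<noteq> 0" "M *v v = l *s v"
    using assms by (auto simp: eigval_def)
  then have "ctranspose (ctranspose (M - mat l)) *v v = 0"
    by (simp add: matrix_vector_mult_diff_rdistrib vec_smult_mat_vector)
  from ker_ctranspose[OF * this] v show False
    by auto
qed

text \<open>For a simple eigenvalue $\lambda$ with left and right eigenvectors \<open>x\<close>, \<open>y\<close>, the matrix
  $M - \lambda I + y x^*$ is invertible, although $M - \lambda I$ is not.\<close>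

definition bordered :: "complex^'n^'n \<Rightarrow> complex \<Rightarrow> complex^'n \<Rightarrow> complex^'n \<Rightarrow> complex^'n^'n" where
  "bordered M l x y = M - mat l + outer y x"

lemma bordered_vector: "bordered M l x y *v z = M *v z - l *s z + cinner x z *s y"
  by (simp add: bordered_def matrix_vector_mult_diff_rdistrib matrix_vector_mult_add_rdistrib
      vec_smult_mat_vector outer_vector)

lemma ctranspose_bordered: "ctranspose (bordered M l x y) = bordered (ctranspose M) (cnj l) y x"
  by (simp add: bordered_def ctranspose_diff ctranspose_add)

lemma simple_eigval_eigvecs:
  fixes M :: "complex^'n^'n"
  assumes "simple_eigval M l"
  obtains x y where "ctranspose M *v x = cnj l *s x" "M *v y = l *s y" "cinner x y \<noteq> 0"
    "\<And>z. bordered M l x y *v z = 0 \<Longrightarrow> z = 0"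
    "\<And>z. bordered (ctranspose M) (cnj l) y x *v z = 0 \<Longrightarrow> z = 0"
proof -
  let ?M = "ctranspose M" and ?l = "cnj l"
  have ord: "order l (charpoly M) = 1"
    using assms by (simp add: simple_eigval_def)
  obtain y where y: "M *v y = l *s y" "y \<noteq> 0"
    using assms by (auto simp: simple_eigval_def eigval_def)
  obtain x where x: "?M *v x = ?l *s x" "x \<noteq> 0"
    using assms eigval_ctranspose[of M l] by (auto simp: simple_eigval_def eigval_def)
  have chain: "\<exists>t. z = t *s x" if "?M *v z = ?l *s z + c *s x" for z c
  proof -
    have "vconj z v* M = vconj (?M *v z)" "vconj x v* M = vconj (?M *v x)"
      by (simp_all add: ctranspose_vector)
    then have "vconj z v* M = l *s vconj z + cnj c *s vconj x" "vconj x v* M = l *s vconj x"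
      by (simp_all add: that x(1)) (simp_all add: vec_eq_iff vconj_def)
    moreover have "vconj x \<noteq> 0"
      using x(2) by (auto simp: vconj_def vec_eq_iff)
    ultimately obtain t where "vconj z = t *s vconj x"
      using simple_eigval_left_chain[OF ord] by metis
    then show ?thesis
      by (metis vconj_smult vconj_vconj)
  qed
  \<comment> \<open>A kernel vector \<open>z\<close> satisfies a chain relation over
    \<open>x\<close>, hence is a multiple of \<open>x\<close>, and the border then forces it to
    vanish. The vector \<open>q\<close> stays free: \<open>q = x\<close> serves to prove
    \<open>cinner x y \<noteq> 0\<close>, after which \<open>q = y\<close> becomes
    available.\<close>
  have inj: "z = 0" if "bordered ?M ?l q x *v z = 0" "cinner q x \<noteq> 0" for q z
  proof -
    have "?M *v z = ?l *s z + (- cinner q z) *s x"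
      using that(1) by (simp add: bordered_vector vec_eq_iff algebra_simps)
    then obtain t where t: "z = t *s x"
      using chain by blast
    have "?M *v z = ?l *s z"
      by (simp add: t vector_scalar_commute x(1) vec_eq_iff)
    then have "(t * cinner q x) *s x = 0"
      using that(1) by (simp add: bordered_vector t)
    then show ?thesis
      using that(2) x(2) t by (simp add: vector_mul_eq_0)
  qed
  have xy: "cinner x y \<noteq> 0"
  proof
    assume "cinner x y = 0"
    \<comment> \<open>With \<open>cinner x y = 0\<close> the border would not see \<open>y\<close>,
      and the adjoint of an injective matrix would have the nonzero kernel vector
      \<open>y\<close>.\<close>
    then have "ctranspose (bordered ?M ?l x x) *v y = 0"
      by (simp add: ctranspose_bordered bordered_vector y)
    moreover have "cinner x x \<noteq> 0"
      using x(2) by (simp add: cinner_self)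
    ultimately have "y = 0"
      using ker_ctranspose[of "bordered ?M ?l x x" y] inj[of x] by blast
    then show False
      using y by simp
  qed
  then have yx: "cinner y x \<noteq> 0"
    by (metis cnj_cinner complex_cnj_zero_iff)
  have "z = 0" if "bordered M l x y *v z = 0" for z
    using ker_ctranspose[of "bordered ?M ?l y x" z] inj[OF _ yx] that
    by (simp add: ctranspose_bordered)
  then show ?thesis
    using that[OF x(1) y(1) xy] inj[OF _ yx] by blast
qed

subsection \<open>Pointwise Lipschitz continuity\<close>

text \<open>Only comparisons with the value at \<open>p\<close> are demanded. This is weaker than a
  local Lipschitz condition, follows from differentiability at the single point \<open>p\<close>,
  and suffices because every estimate is made against the stationary point.\<close>

definition lip_at :: "'a::real_normed_vector \<Rightarrow> ('a \<Rightarrow> 'b::real_normed_vector) \<Rightarrow> bool" where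
  "lip_at p g \<longleftrightarrow> (\<exists>L. \<forall>\<^sub>F e in nhds p. norm (g e - g p) \<le> L * norm (e - p))"

lemma lip_atE:
  assumes "lip_at p g"
  obtains L where "L > 0" "\<forall>\<^sub>F e in nhds p. norm (g e - g p) \<le> L * norm (e - p)"
proof -
  obtain L where L: "\<forall>\<^sub>F e in nhds p. norm (g e - g p) \<le> L * norm (e - p)"
    using assms by (auto simp: lip_at_def)
  have "\<forall>\<^sub>F e in nhds p. norm (g e - g p) \<le> (\<bar>L\<bar> + 1) * norm (e - p)"
    using L by eventually_elim (rule order_trans, assumption, auto intro: mult_right_mono)
  then show ?thesis
    by (intro that[of "\<bar>L\<bar> + 1"]) auto
qed

lemma lip_at_tendsto:
  assumes "lip_at p g"
  shows "(g \<longlongrightarrow> g p) (nhds p)"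
proof -
  obtain L where L: "\<forall>\<^sub>F e in nhds p. norm (g e - g p) \<le> L * norm (e - p)"
    using assms by (auto simp: lip_at_def)
  have "((\<lambda>e. L * norm (e - p)) \<longlongrightarrow> L * norm (p - p)) (nhds p)"
    by (intro tendsto_intros filterlim_ident)
  then have "((\<lambda>e. L * norm (e - p)) \<longlongrightarrow> 0) (nhds p)"
    by simp
  then have "((\<lambda>e. g e - g p) \<longlongrightarrow> 0) (nhds p)"
    by (rule Lim_null_comparison[OF L])
  then show ?thesis
    by (simp add: LIM_zero_iff)
qed

lemma lip_at_const: "lip_at p (\<lambda>e. c)"
  unfolding lip_at_def by (rule exI[of _ 0]) simp

lemma lip_at_bilinear:
  assumes "bounded_bilinear b" "lip_at p g" "lip_at p h"
  shows "lip_at p (\<lambda>e. b (g e) (h e))"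
proof -
  interpret bounded_bilinear b by fact
  obtain K where K: "K > 0" "\<And>u v. norm (b u v) \<le> norm u * norm v * K"
    using pos_bounded by blast
  obtain L where L: "L > 0" "\<forall>\<^sub>F e in nhds p. norm (g e - g p) \<le> L * norm (e - p)"
    using lip_atE[OF assms(2)] .
  obtain L' where L': "L' > 0" "\<forall>\<^sub>F e in nhds p. norm (h e - h p) \<le> L' * norm (e - p)"
    using lip_atE[OF assms(3)] .
  have "\<forall>\<^sub>F e in nhds p. norm (h e) < norm (h p) + 1"
    using tendsto_norm[OF lip_at_tendsto[OF assms(3)]] by (rule order_tendstoD) simp
  with L(2) L'(2) have "\<forall>\<^sub>F e in nhds p. norm (b (g e) (h e) - b (g p) (h p))
    \<le> (L * (norm (h p) + 1) * K + norm (g p) * L' * K) * norm (e - p)"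
  proof eventually_elim
    case (elim e)
    have "b (g e) (h e) - b (g p) (h p) = b (g e - g p) (h e) + b (g p) (h e - h p)"
      by (simp add: diff_left diff_right)
    then have "norm (b (g e) (h e) - b (g p) (h p))
      \<le> norm (g e - g p) * norm (h e) * K + norm (g p) * norm (h e - h p) * K"
      by (metis K(2) add_mono norm_triangle_le)
    also have "\<dots> \<le> (L * norm (e - p)) * (norm (h p) + 1) * K + norm (g p) * (L' * norm (e - p)) * K"
      using elim K(1) L(1) by (intro add_mono mult_mono mult_right_mono mult_left_mono) auto
    finally show ?case
      by (simp add: algebra_simps)
  qed
  then show ?thesis
    unfolding lip_at_def by blast
qed

lemma lip_at_linear:
  assumes "bounded_linear b" "lip_at p g"
  shows "lip_at p (\<lambda>e. b (g e))"
proof -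
  interpret bounded_linear b by fact
  obtain K where K: "K > 0" "\<And>u. norm (b u) \<le> norm u * K"
    using pos_bounded by blast
  obtain L where L: "\<forall>\<^sub>F e in nhds p. norm (g e - g p) \<le> L * norm (e - p)"
    using assms(2) by (auto simp: lip_at_def)
  then have "\<forall>\<^sub>F e in nhds p. norm (b (g e) - b (g p)) \<le> (L * K) * norm (e - p)"
  proof eventually_elim
    case (elim e)
    have "norm (b (g e) - b (g p)) \<le> norm (g e - g p) * K"
      using K(2)[of "g e - g p"] by (simp add: diff)
    also have "\<dots> \<le> (L * norm (e - p)) * K"
      using elim K(1) by (intro mult_right_mono) auto
    finally show ?case
      by (simp add: algebra_simps)
  qed
  then show ?thesis
    unfolding lip_at_def by blast
qed

lemma differentiable_imp_lip_at:
  assumes "g differentiable at p"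
  shows "lip_at p g"
proof -
  obtain D where D: "(g has_derivative D) (at p)"
    using assms by (auto simp: differentiable_def)
  then obtain d where d: "d > 0"
    "\<And>e. norm (e - p) < d \<Longrightarrow> norm (g e - g p - D (e - p)) \<le> 1 * norm (e - p)"
    unfolding has_derivative_at_alt by (meson zero_less_one)
  interpret bounded_linear D
    using D by (rule has_derivative_bounded_linear)
  obtain K where K: "\<And>u. norm (D u) \<le> norm u * K"
    using bounded by blast
  have "norm (g e - g p) \<le> (K + 1) * norm (e - p)" if "dist e p < d" for e
    using d(2)[of e] K[of "e - p"] norm_triangle_ineq[of "g e - g p - D (e - p)" "D (e - p)"] that
    by (simp add: dist_norm algebra_simps)
  then show ?thesis
    unfolding lip_at_def eventually_nhds_metric using d(1) by blast
qed

lemma lip_at_compose: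
  assumes "lip_at (g p) h" "lip_at p g"
  shows "lip_at p (\<lambda>e. h (g e))"
proof -
  obtain L where L: "L > 0" "\<forall>\<^sub>F u in nhds (g p). norm (h u - h (g p)) \<le> L * norm (u - g p)"
    using lip_atE[OF assms(1)] .
  obtain L' where L': "\<forall>\<^sub>F e in nhds p. norm (g e - g p) \<le> L' * norm (e - p)"
    using assms(2) by (auto simp: lip_at_def)
  have "\<forall>\<^sub>F e in nhds p. norm (h (g e) - h (g p)) \<le> L * norm (g e - g p)"
    using L(2) lip_at_tendsto[OF assms(2)] by (rule eventually_compose_filterlim)
  with L' have "\<forall>\<^sub>F e in nhds p. norm (h (g e) - h (g p)) \<le> (L * L') * norm (e - p)"
  proof eventually_elim
    case (elim e)
    then show ?case
      using mult_left_mono[OF elim(1), of L] L(1) by (auto simp: mult.assoc intro: order_trans)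
  qed
  then show ?thesis
    unfolding lip_at_def by blast
qed

lemma lip_at_cong:
  assumes "\<forall>\<^sub>F e in nhds p. g e = h e" "lip_at p h"
  shows "lip_at p g"
proof -
  obtain L where L: "\<forall>\<^sub>F e in nhds p. norm (h e - h p) \<le> L * norm (e - p)"
    using assms(2) by (auto simp: lip_at_def)
  have p: "g p = h p"
    using assms(1) by (rule eventually_nhds_x_imp_x)
  have "\<forall>\<^sub>F e in nhds p. norm (g e - g p) \<le> L * norm (e - p)"
    using assms(1) L by eventually_elim (simp add: p)
  then show ?thesis
    unfolding lip_at_def by blast
qed

text \<open>\<open>sgn\<close> both normalizes the eigenvectors and extracts the phase of their
  inner product. The bound holds for every \<open>u\<close>, including \<open>u = 0\<close> with
  \<open>sgn 0 = 0\<close>.\<close>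

lemma lip_at_sgn:
  fixes a :: "'a::real_normed_vector"
  assumes "a \<noteq> 0"
  shows "lip_at a sgn"
proof -
  have "norm (sgn u - sgn a) \<le> 2 / norm a * norm (u - a)" for u
  proof -
    have "norm a *\<^sub>R (sgn u - sgn a) = (norm a - norm u) *\<^sub>R sgn u + (u - a)"
      using assms by (cases "u = 0") (simp_all add: sgn_div_norm algebra_simps)
    then have "norm a * norm (sgn u - sgn a) \<le> norm ((norm a - norm u) *\<^sub>R sgn u) + norm (u - a)"
      by (metis norm_scaleR abs_norm_cancel norm_triangle_ineq)
    also have "\<dots> \<le> norm (u - a) + norm (u - a)"
      using norm_triangle_ineq3[of a u] by (simp add: norm_sgn norm_minus_commute)
    finally show ?thesis
      using assms by (simp add: field_simps)
  qed
  then show ?thesis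
    unfolding lip_at_def by (intro exI[of _ "2 / norm a"] always_eventually) blast
qed

section \<open>Boundedness of the matrix operations\<close>

lemma bounded_bilinear_matrix_vector:
  "bounded_bilinear (\<lambda>(M :: complex^'n^'n) v. M *v v)"
  by (simp add: bilinear_conv_bounded_bilinear[symmetric] bilinear_def linear_iff vec_eq_iff
      matrix_vector_mult_def algebra_simps sum.distrib scaleR_sum_right)

lemma bounded_bilinear_matrix_matrix:
  "bounded_bilinear (\<lambda>(M :: complex^'n^'n) (N :: complex^'n^'n). M ** N)"
  by (simp add: bilinear_conv_bounded_bilinear[symmetric] bilinear_def linear_iff vec_eq_iff
      matrix_matrix_mult_def algebra_simps sum.distrib scaleR_sum_right)

lemma bounded_bilinear_cinner: "bounded_bilinear (cinner :: complex^'n \<Rightarrow> _)"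
  by (simp add: bilinear_conv_bounded_bilinear[symmetric] bilinear_def linear_iff cinner_def
      algebra_simps sum.distrib scaleR_sum_right)

lemma bounded_bilinear_outer: "bounded_bilinear (outer :: complex^'n \<Rightarrow> _)"
  by (simp add: bilinear_conv_bounded_bilinear[symmetric] bilinear_def linear_iff vec_eq_iff outer_def
      algebra_simps)

lemma bounded_bilinear_cscale: "bounded_bilinear (cscale :: complex \<Rightarrow> complex^'n^'n \<Rightarrow> _)"
  by (simp add: bilinear_conv_bounded_bilinear[symmetric] bilinear_def linear_iff vec_eq_iff cscale_def
      map_matrix_def algebra_simps)

lemma bounded_linear_ctranspose: "bounded_linear (ctranspose :: complex^'n^'n \<Rightarrow> _)"
  by (simp add: linear_conv_bounded_linear[symmetric] linear_iff vec_eq_iff ctranspose_def)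

subsection \<open>Perturbation of a simple eigenvalue\<close>

text \<open>An eigenvector \<open>v\<close> of \<open>M e\<close> normalized by $x^* v = 1$ solves the linear system
  \<open>bordered (M e) (l e) x y *v v = y\<close>, whose matrix is injective uniformly for \<open>e\<close> near \<open>p\<close>.\<close>

lemma lip_at_eigenvector:
  fixes M :: "'a::real_normed_vector \<Rightarrow> complex^'n^'n"
  assumes M: "lip_at p M" and l: "(l \<longlongrightarrow> l p) (nhds p)"
    and x: "ctranspose (M p) *v x = cnj (l p) *s x"
    and inj: "\<And>z. bordered (M p) (l p) x y *v z = 0 \<Longrightarrow> z = 0"
    and ev: "\<And>e. eigval (M e) (l e)"
  obtains v where "lip_at p l" "lip_at p v"
    "\<forall>\<^sub>F e in nhds p. v e \<noteq> 0 \<and> M e *v v e = l e *s v e \<and>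
      (\<forall>u. M e *v u = l e *s u \<longrightarrow> (\<exists>c. u = c *s v e))"
proof -
  define T where "T = (\<lambda>e z. bordered (M e) (l e) x y *v z)"
  have T: "T e z = M e *v z - l e *s z + cinner x z *s y" for e z
    by (simp add: T_def bordered_vector)
  \<comment> \<open>The border is the same for all \<open>e\<close> and cancels.\<close>
  have T_diff: "T e z - T p z = (M e - M p) *v z - (l e - l p) *s z" for e z
    by (simp add: T vec_eq_iff matrix_vector_mult_diff_rdistrib algebra_simps)
  obtain K where K: "K > 0" "\<And>(N :: complex^'n^'n) z. norm (N *v z) \<le> norm N * norm z * K"
    using bounded_bilinear.pos_bounded[OF bounded_bilinear_matrix_vector] by metis
  have lin: "linear (T p)"
    unfolding T_def by simp
  then have "inj (T p)"
    using inj by (simp add: linear_injective_0 T_def)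
  then obtain \<kappa> where \<kappa>: "\<kappa> > 0" "\<And>z. \<kappa> * norm z \<le> norm (T p z)"
    using linear_inj_bounded_below_pos[OF lin] by metis
  obtain L where L: "L > 0" "\<forall>\<^sub>F e in nhds p. norm (M e - M p) \<le> L * norm (e - p)"
    using lip_atE[OF M] .
  have "((\<lambda>e. norm (M e - M p) * K + norm (l e - l p)) \<longlongrightarrow>
      norm (M p - M p) * K + norm (l p - l p)) (nhds p)"
    by (intro tendsto_intros lip_at_tendsto M l)
  \<comment> \<open>A perturbation of size below \<open>\<kappa> / 2\<close> leaves half of the
    lower bound \<kappa> of \<open>T p\<close>.\<close>
  then have "\<forall>\<^sub>F e in nhds p. norm (M e - M p) * K + norm (l e - l p) < \<kappa> / 2"
    using \<kappa>(1) by (intro order_tendstoD(2)) auto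
  then have low: "\<forall>\<^sub>F e in nhds p. \<forall>z. \<kappa> / 2 * norm z \<le> norm (T e z)"
  proof eventually_elim
    case (elim e)
    show ?case
    proof
      fix z
      have "norm (T e z - T p z) \<le> norm ((M e - M p) *v z) + norm ((l e - l p) *s z)"
        unfolding T_diff by (rule norm_triangle_ineq4)
      also have "\<dots> \<le> norm (M e - M p) * norm z * K + norm (l e - l p) * norm z"
        unfolding norm_vec_smult using K(2)[of "M e - M p" z] by simp
      also have "\<dots> = (norm (M e - M p) * K + norm (l e - l p)) * norm z"
        by (simp add: algebra_simps)
      also have "\<dots> \<le> \<kappa> / 2 * norm z"
        using elim by (intro mult_right_mono) auto
      finally have "norm (T e z - T p z) \<le> \<kappa> / 2 * norm z" .
      then show "\<kappa> / 2 * norm z \<le> norm (T e z)"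
        using \<kappa>(2)[of z] norm_triangle_ineq3[of "T p z" "T e z"] by (simp add: norm_minus_commute)
    qed
  qed
  define v where "v = (\<lambda>e. SOME v. M e *v v = l e *s v \<and> cinner x v = 1)"
  have v: "\<forall>\<^sub>F e in nhds p. (M e *v v e = l e *s v e \<and> cinner x (v e) = 1) \<and>
      (\<forall>u. M e *v u = l e *s u \<longrightarrow> u = cinner x u *s v e)"
    using low
  proof eventually_elim
    case (elim e)
    \<comment> \<open>An eigenvector with \<open>cinner x u = 0\<close> would lie in the kernel of
      \<open>T e\<close>. Hence every eigenvector can be rescaled to \<open>cinner x u = 1\<close>,
      and the difference of two rescaled ones vanishes, which makes the eigenspace a line.\<close>
    have uniq: "u = 0" if "M e *v u = l e *s u" "cinner x u = 0" for u
      using elim[rule_format, of u] that \<kappa>(1) by (simp add: T mult_le_0_iff)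
    obtain u where u: "M e *v u = l e *s u" "u \<noteq> 0"
      using ev[of e] by (auto simp: eigval_def)
    then have "cinner x u \<noteq> 0"
      using uniq by blast
    then have "M e *v (inverse (cinner x u) *s u) = l e *s (inverse (cinner x u) *s u) \<and>
      cinner x (inverse (cinner x u) *s u) = 1"
      using u by (simp add: vector_scalar_commute vec_eq_iff)
    then have v: "M e *v v e = l e *s v e \<and> cinner x (v e) = 1"
      unfolding v_def by (rule someI)
    moreover have "u = cinner x u *s v e" if "M e *v u = l e *s u" for u
    proof -
      have "M e *v (u - cinner x u *s v e) = l e *s (u - cinner x u *s v e)"
        using v that by (simp add: matrix_vector_mult_diff_distrib vector_scalar_commute vec_eq_iff algebra_simps)
      then have "u - cinner x u *s v e = 0"
        using v by (intro uniq) (auto simp: cinner_diff_right)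
      then show ?thesis
        by simp
    qed
    ultimately show ?case
      by blast
  qed
  \<comment> \<open>This comes from \<open>T e (v e) = y\<close> and the lower bound
    \<open>\<kappa> / 2\<close>.\<close>
  define R where "R = 2 * norm y / \<kappa>"
  have R: "R \<ge> 0"
    using \<kappa>(1) by (simp add: R_def)
  have bnd: "\<forall>\<^sub>F e in nhds p. norm (v e) \<le> R"
    using v low
  proof eventually_elim
    case (elim e)
    then have "T e (v e) = y"
      by (simp add: T)
    with elim(2) have "\<kappa> / 2 * norm (v e) \<le> norm y"
      by metis
    then show ?case
      using \<kappa>(1) by (simp add: R_def field_simps)
  qed
  obtain B where B: "B > 0" "\<And>z. norm (cinner x z) \<le> norm z * B"
    using bounded_linear.pos_bounded[OF bounded_bilinear.bounded_linear_right[OF bounded_bilinear_cinner]]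
    by metis
  have l_lip: "\<forall>\<^sub>F e in nhds p. norm (l e - l p) \<le> (L * R * K * B) * norm (e - p)"
    using v bnd L(2)
  proof eventually_elim
    case (elim e)
    have "l e = cinner x (M e *v v e)"
      using elim by simp
    \<comment> \<open>Although \<open>v e\<close> is no eigenvector of \<open>M p\<close>, the left
      eigenvector \<open>x\<close> yields \<open>l p\<close> from any vector with inner product 1.
      So \<open>l e - l p\<close> is expressed through \<open>M e - M p\<close> alone, and mere
      continuity of \<open>l\<close> becomes a Lipschitz bound.\<close>
    moreover have "l p = cinner x (M p *v v e)"
      using elim by (simp flip: cinner_ctranspose add: x)
    ultimately have "l e - l p = cinner x ((M e - M p) *v v e)"
      by (simp only: matrix_vector_mult_diff_rdistrib cinner_diff_right)
    then have "norm (l e - l p) \<le> norm ((M e - M p) *v v e) * B"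
      using B(2)[of "(M e - M p) *v v e"] by (simp only:)
    also have "\<dots> \<le> norm (M e - M p) * norm (v e) * K * B"
      using K(2)[of "M e - M p" "v e"] B(1) by (intro mult_right_mono) auto
    also have "\<dots> \<le> (L * norm (e - p)) * R * K * B"
      using elim K(1) B(1) L(1) R by (intro mult_right_mono mult_mono) auto
    finally show ?case
      by (simp add: algebra_simps)
  qed
  have v_p: "M p *v v p = l p *s v p" "cinner x (v p) = 1"
    using eventually_nhds_x_imp_x[OF v] by auto
  have "\<forall>\<^sub>F e in nhds p. norm (v e - v p) \<le>
      ((L * R * K + (L * R * K * B) * R) / \<kappa>) * norm (e - p)"
    using v bnd L(2) l_lip
  proof eventually_elim
    case (elim e)
    \<comment> \<open>Both sides equal \<open>y\<close>, so \<open>T p (v e - v p)\<close> is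
      controlled by the difference of the two operators at the bounded vector
      \<open>v e\<close>.\<close>
    have "T e (v e) = T p (v p)"
      using elim v_p by (simp add: T)
    then have "T p (v e - v p) = - (T e (v e) - T p (v e))"
      using linear_diff[OF lin, of "v e" "v p"] by simp
    then have "\<kappa> * norm (v e - v p) \<le> norm ((M e - M p) *v v e - (l e - l p) *s v e)"
      by (metis \<kappa>(2) T_diff norm_minus_cancel)
    also have "\<dots> \<le> norm (M e - M p) * norm (v e) * K + norm (l e - l p) * norm (v e)"
      using norm_triangle_ineq4[of "(M e - M p) *v v e" "(l e - l p) *s v e"] K(2)[of "M e - M p" "v e"]
      unfolding norm_vec_smult by linarith
    also have "\<dots> \<le> (L * norm (e - p)) * R * K + ((L * R * K * B) * norm (e - p)) * R"
      using elim K(1) B(1) L(1) R by (intro add_mono mult_right_mono mult_mono) auto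
    finally show ?case
      using \<kappa>(1) by (simp add: field_simps)
  qed
  then have "lip_at p v"
    unfolding lip_at_def by blast
  moreover have "lip_at p l"
    using l_lip unfolding lip_at_def by blast
  moreover have "\<forall>\<^sub>F e in nhds p. v e \<noteq> 0 \<and> M e *v v e = l e *s v e \<and>
      (\<forall>u. M e *v u = l e *s u \<longrightarrow> (\<exists>c. u = c *s v e))"
    using v by eventually_elim auto
  ultimately show ?thesis
    using that by blast
qed

section \<open>Normalized eigenpairs and their phase\<close>

lemma cscale_cscale: "cscale a (cscale b M) = cscale (a * b) M"
  by (simp add: cscale_def map_matrix_def vec_eq_iff mult.assoc)

lemma outer_smult: "outer (a *s x) (b *s y) = cscale (a * cnj b) (outer x y)"
  by (simp add: cscale_def map_matrix_def outer_def vec_eq_iff mult_ac)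

lemma cscale_outer: "cscale c (outer a b) = outer (c *s a) b"
  by (simp add: cscale_def map_matrix_def outer_def vec_eq_iff mult_ac)

lemma sgn_eq_smult: "sgn v = complex_of_real (inverse (norm v)) *s (v :: complex^'n)"
  by (simp add: sgn_vec_def vec_eq_iff scaleR_conv_of_real[where 'a = complex])

text \<open>Positivity makes \<open>c * z\<close> equal to its own modulus \<open>norm z\<close>;
  multiplying by \<open>cnj c\<close> gives the polar form of \<open>z\<close>.\<close>

lemma phase_unique:
  assumes "Re (c * z) > 0" "c * z \<in> \<real>" "norm c = (1::real)"
  shows "cnj c = sgn z"
proof -
  obtain r where r: "c * z = complex_of_real r"
    using assms(2) by (auto elim: Reals_cases)
  then have "r > 0"
    using assms(1) by (metis Re_complex_of_real)
  then have "c * z = complex_of_real (norm (c * z))"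
    by (simp add: r)
  then have "cnj c * (c * z) = cnj c * complex_of_real (norm z)"
    using assms(3) by (simp add: norm_mult)
  moreover have "cnj c * c = 1"
    using assms(3) by (metis complex_norm_square mult.commute of_real_1 power_one)
  ultimately have "z = cnj c * complex_of_real (norm z)"
    by (metis mult.assoc mult_1)
  moreover have "z \<noteq> 0"
    using assms(1) by auto
  ultimately show ?thesis
    by (metis nonzero_eq_divide_eq norm_eq_zero of_real_eq_0_iff sgn_eq)
qed

text \<open>For \<open>x = a *s w\<close> and \<open>y = b *s v\<close> only
  \<open>a * cnj b\<close> enters \<open>outer x y\<close>. The unit norms fix its modulus and the
  positivity of \<open>cinner x y\<close> fixes its phase, so the outer product is an explicit
  expression in arbitrarily scaled eigenvectors.\<close>

lemma outer_eigpair: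
  fixes w v :: "complex^'n"
  assumes w: "w \<noteq> 0" "ctranspose M *v w = cnj l *s w"
      "\<And>u. ctranspose M *v u = cnj l *s u \<Longrightarrow> \<exists>c. u = c *s w"
    and v: "v \<noteq> 0" "M *v v = l *s v" "\<And>u. M *v u = l *s u \<Longrightarrow> \<exists>c. u = c *s v"
    and wv: "cinner w v \<noteq> 0"
  shows "\<exists>x y. eigpair M l x y"
    and "\<And>x y. eigpair M l x y \<Longrightarrow> outer x y = cscale (sgn (cinner w v)) (outer (sgn w) (sgn v))"
proof -
  let ?s = "sgn (cinner w v)"
  have "eigpair M l (?s *s sgn w) (sgn v)"
  proof -
    have "cinner (?s *s sgn w) (sgn v) = complex_of_real (norm (cinner w v) * inverse (norm w) * inverse (norm v))"
      using wv by (simp add: sgn_eq_smult[of w] sgn_eq_smult[of v])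
        (simp add: sgn_eq complex_norm_square power2_eq_square field_simps flip: complex_norm_square)
    moreover have "norm (cinner w v) * inverse (norm w) * inverse (norm v) > 0"
      using w(1) v(1) wv by simp
    ultimately have "cinner (?s *s sgn w) (sgn v) \<in> \<real>" "Re (cinner (?s *s sgn w) (sgn v)) > 0"
      by (simp_all only: Reals_of_real Re_complex_of_real)
    moreover have "ctranspose M *v (?s *s sgn w) = cnj l *s (?s *s sgn w)"
      unfolding sgn_eq_smult[of w] vector_scalar_commute w(2) by (simp add: vec_eq_iff)
    moreover have "M *v sgn v = l *s sgn v"
      unfolding sgn_eq_smult[of v] vector_scalar_commute v(2) by (simp add: vec_eq_iff)
    moreover have "norm (?s *s sgn w) = 1" "norm (sgn v) = 1"
      unfolding norm_vec_smult norm_sgn using w(1) v(1) wv by simp_all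
    ultimately show ?thesis
      unfolding eigpair_def left_eigvec_iff by blast
  qed
  then show "\<exists>x y. eigpair M l x y"
    by blast
  fix x y
  assume xy: "eigpair M l x y"
  then obtain a b where ab: "x = a *s w" "y = b *s v"
    using w(3) v(3) unfolding eigpair_def left_eigvec_iff by blast
  \<comment> \<open>The positive factor turns \<open>cnj a * b\<close> into a number of modulus
    1.\<close>
  define c where "c = cnj a * b * complex_of_real (norm w * norm v)"
  have n: "norm a * norm w = 1" "norm b * norm v = 1"
    using xy by (simp_all add: eigpair_def ab)
  have "norm c = (norm a * norm w) * (norm b * norm v)"
    by (simp add: c_def norm_mult)
  then have "norm c = 1"
    using n by simp
  moreover have "c * cinner w v = complex_of_real (norm w * norm v) * cinner x y"
    by (simp add: c_def ab)
  moreover have "norm w * norm v > 0"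
    using w(1) v(1) by simp
  moreover have "cinner x y \<in> \<real>" "Re (cinner x y) > 0"
    using xy by (simp_all add: eigpair_def)
  ultimately have "cnj c = ?s"
    by (intro phase_unique) (auto intro: Reals_mult)
  then have "a * cnj b = ?s * complex_of_real (inverse (norm w)) * complex_of_real (inverse (norm v))"
    using w(1) v(1) by (simp add: c_def field_simps flip: \<open>cnj c = ?s\<close>)
  then show "outer x y = cscale ?s (outer (sgn w) (sgn v))"
    by (simp add: ab sgn_eq_smult[of w] sgn_eq_smult[of v] outer_smult cscale_cscale mult.assoc)
qed

subsection \<open>The tangent space projection\<close>

lemma matrix_outer: "M ** outer a b = outer (M *v a) b"
  by (simp add: outer_def matrix_matrix_mult_def matrix_vector_mult_def vec_eq_iff sum_distrib_right mult.assoc)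

lemma outer_matrix: "outer a b ** M = outer a (ctranspose M *v b)"
  by (metis ctranspose_ctranspose ctranspose_mult ctranspose_outer matrix_outer)

lemma norm_vconj [simp]: "norm (vconj b) = norm b"
  by (simp add: norm_vec_def vconj_def)

lemma norm_outer: "norm (outer a b) = norm a * norm b"
proof -
  have "outer a b $ i = a $ i *s vconj b" for i
    by (simp add: outer_def vconj_def vec_eq_iff)
  then have "norm (outer a b) = L2_set (\<lambda>i. norm (a $ i) * norm b) UNIV"
    by (simp add: norm_vec_def[of "outer a b"])
  then show ?thesis
    by (simp add: norm_vec_def[of a] L2_set_left_distrib)
qed

lemma rank1_decomp:
  assumes "Y \<in> rank1"
  obtains \<sigma> u v where "\<sigma> \<noteq> 0" "norm u = 1" "norm v = 1" "Y = cscale \<sigma> (outer u v)"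
proof -
  have "vec.dim (rows Y) = 1"
    using assms by (simp add: rank1_def row_rank_def_gen)
  then obtain B where B: "B \<subseteq> rows Y" "vec.independent B" "rows Y \<subseteq> vec.span B" "card B = 1"
    using vec.basis_exists[of "rows Y"] by metis
  then obtain b where b: "B = {b}"
    using card_1_singletonE by blast
  have "b \<noteq> 0"
    using B(2) b by auto
  have "\<exists>c. Y $ i = c *s b" for i
  proof -
    have "row i Y \<in> vec.span {b}"
      using B(3) b by (auto simp: rows_def)
    then show ?thesis
      by (auto simp: vec.span_singleton row_def)
  qed
  then obtain c where c: "\<And>i. Y $ i = c i *s b"
    by metis
  define a where "a = (\<chi> i. c i)"
  have Y: "Y = outer a (vconj b)"
    by (simp add: outer_def vconj_def vec_eq_iff c a_def)
  obtain i where "Y $ i = b"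
    using B(1) b by (auto simp: rows_def row_def)
  then have "a $ i \<noteq> 0"
    using \<open>b \<noteq> 0\<close> c[of i] by (auto simp: a_def)
  then have "a \<noteq> 0"
    by auto
  have "Y = cscale (complex_of_real (norm a * norm b)) (outer (sgn a) (sgn (vconj b)))"
  proof -
    have "complex_of_real (norm a * norm b) *
        (complex_of_real (inverse (norm a)) * cnj (complex_of_real (inverse (norm b)))) = 1"
      using \<open>a \<noteq> 0\<close> \<open>b \<noteq> 0\<close> by (simp add: field_simps)
    then show ?thesis
      unfolding sgn_eq_smult[of a] sgn_eq_smult[of "vconj b"] norm_vconj outer_smult cscale_cscale
      by (simp add: Y cscale_def map_matrix_def vec_eq_iff)
  qed
  moreover have "norm (sgn a) = 1" "norm (sgn (vconj b)) = 1"
    using \<open>a \<noteq> 0\<close> \<open>b \<noteq> 0\<close> by (auto simp: norm_sgn) (metis norm_eq_zero norm_vconj)+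
  ultimately show ?thesis
    using that[of "complex_of_real (norm a * norm b)" "sgn a" "sgn (vconj b)"] \<open>a \<noteq> 0\<close> \<open>b \<noteq> 0\<close>
    by simp
qed

text \<open>Applying both decompositions to \<open>v\<close> shows that \<open>u\<close> is a unit
  multiple of \<open>u'\<close>, and the unit factor cancels against its conjugate.\<close>

lemma outer_self_unique:
  assumes "cscale \<sigma> (outer u v) = cscale \<sigma>' (outer u' v')" "\<sigma> \<noteq> 0"
    "norm u = 1" "norm v = 1" "norm u' = 1"
  shows "outer u u = outer u' u'"
proof -
  have "cscale \<sigma> (outer u v) *v v = \<sigma> *s u"
    using assms(4) by (simp add: cscale_outer outer_vector cinner_self)
  moreover have "cscale \<sigma>' (outer u' v') *v v = (cinner v' v * \<sigma>') *s u'"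
    by (simp add: cscale_outer outer_vector)
  ultimately have "\<sigma> *s u = (cinner v' v * \<sigma>') *s u'"
    using assms(1) by simp
  then have u: "u = (cinner v' v * \<sigma>' / \<sigma>) *s u'"
    using assms(2) by (simp add: vec_eq_iff field_simps)
  define t where "t = cinner v' v * \<sigma>' / \<sigma>"
  have "norm t = 1"
    using u assms(3,5) by (metis norm_vec_smult mult.right_neutral t_def)
  then have "t * cnj t = 1"
    by (simp add: complex_norm_square[symmetric])
  then show ?thesis
    unfolding u t_def[symmetric] outer_smult by (simp add: cscale_def map_matrix_def vec_eq_iff)
qed

lemma ctranspose_cscale: "ctranspose (cscale c M) = cscale (cnj c) (ctranspose M)"
  by (simp add: ctranspose_def cscale_def map_matrix_def vec_eq_iff)

lemma tproj_eq:
  assumes "\<sigma> \<noteq> 0" "norm u = 1" "norm v = 1" "Y = cscale \<sigma> (outer u v)"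
  shows "tproj Y Z = Z - (mat 1 - outer u u) ** Z ** (mat 1 - outer v v)"
  unfolding tproj_def
proof (rule the_equality)
  fix W
  assume "\<exists>\<sigma> u v. norm u = 1 \<and> norm v = 1 \<and> Y = cscale \<sigma> (outer u v) \<and>
    W = Z - (mat 1 - outer u u) ** Z ** (mat 1 - outer v v)"
  then obtain \<sigma>' u' v' where *: "norm u' = 1" "norm v' = 1" "Y = cscale \<sigma>' (outer u' v')"
    "W = Z - (mat 1 - outer u' u') ** Z ** (mat 1 - outer v' v')"
    by blast
  have eq: "cscale \<sigma> (outer u v) = cscale \<sigma>' (outer u' v')"
    using assms(4) *(3) by simp
  \<comment> \<open>The adjoint exchanges the roles of \<open>u\<close> and \<open>v\<close>, so the
    same uniqueness also covers the second projection.\<close>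
  then have "cscale (cnj \<sigma>) (outer v u) = cscale (cnj \<sigma>') (outer v' u')"
    by (metis ctranspose_cscale ctranspose_outer)
  then have "outer v v = outer v' v'"
    by (rule outer_self_unique) (use assms * in auto)
  moreover have "outer u u = outer u' u'"
    using eq by (rule outer_self_unique) (use assms * in auto)
  ultimately show "W = Z - (mat 1 - outer u u) ** Z ** (mat 1 - outer v v)"
    using * by simp
qed (use assms in blast)

lemma complement_vector: "(mat 1 - outer u u) *v z = z - cinner u z *s u"
  by (simp add: matrix_vector_mult_diff_rdistrib outer_vector)

lemma ctranspose_complement: "ctranspose (mat 1 - outer u u) = mat 1 - outer u u"
  by (simp add: ctranspose_diff)

lemma cscale_of_real: "cscale (complex_of_real r) M = r *\<^sub>R M"
  by (simp add: cscale_def map_matrix_def vec_eq_iff scaleR_conv_of_real[where 'a = complex])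

text \<open>The normal part \<open>p ** outer a b ** q\<close> annihilates \<open>v\<close> on the
  right and \<open>u\<close> on the left. As the coefficient \<open>k\<close> of the tangential part
  is nonzero, \<open>a\<close> must lie on the line of \<open>u\<close> and \<open>b\<close> on that
  of \<open>v\<close>; with \<open>k = 0\<close> the whole matrix could be normal.\<close>

lemma tproj_fixed_multiple:
  assumes "Y \<in> rank1" "tproj Y (outer a b) = \<nu> *\<^sub>R Y" "tproj Y (outer a b) \<noteq> 0"
  shows "outer a b = \<nu> *\<^sub>R Y"
proof -
  obtain \<sigma> u v where Y: "\<sigma> \<noteq> 0" "norm u = 1" "norm v = 1" "Y = cscale \<sigma> (outer u v)"
    using rank1_decomp[OF assms(1)] .
  define k where "k = complex_of_real \<nu> * \<sigma>"
  define p where "p = mat 1 - outer u u"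
  define q where "q = mat 1 - outer v v"
  have W: "\<nu> *\<^sub>R Y = outer (k *s u) v"
    by (simp add: Y(4) k_def cscale_cscale cscale_outer flip: cscale_of_real)
  have "k \<noteq> 0"
    using assms(2,3) unfolding W by (auto simp: outer_def vec_eq_iff)
  have pu: "p *v u = 0" and qv: "q *v v = 0"
    using Y by (simp_all add: p_def q_def complement_vector cinner_self)
  have split: "outer a b = outer (k *s u) v + p ** outer a b ** q"
    using tproj_eq[OF Y, of "outer a b"] assms(2) W by (simp add: p_def q_def algebra_simps)
  have "outer a b *v v = outer (k *s u) v *v v + p *v (outer a b *v (q *v v))"
    by (subst split) (simp add: matrix_vector_mult_add_rdistrib matrix_vector_mul_assoc matrix_mul_assoc)
  then have a: "cinner b v *s a = k *s u"
    using Y by (simp add: qv outer_vector cinner_self)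
  have "ctranspose (outer a b) = ctranspose (outer (k *s u) v) + q ** ctranspose (outer a b) ** p"
    by (subst split) (simp only: ctranspose_add ctranspose_mult p_def q_def ctranspose_complement matrix_mul_assoc)
  then have "outer b a *v u = outer v (k *s u) *v u + q *v (outer b a *v (p *v u))"
    by (metis ctranspose_outer matrix_vector_mult_add_rdistrib matrix_vector_mul_assoc)
  then have b: "cinner a u *s b = cnj k *s v"
    using Y by (simp add: pu outer_vector cinner_self)
  have "cinner b v * cinner u a = cinner u (cinner b v *s a)"
    by simp
  also have "\<dots> = k"
    using Y by (simp add: a cinner_self)
  finally have k: "cinner b v * cinner u a = k" .
  with \<open>k \<noteq> 0\<close> have nz: "cinner b v \<noteq> 0" "cinner u a \<noteq> 0"
    by auto
  have "a = cinner u a *s u"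
    using a nz(1) by (simp add: vec_eq_iff flip: k)
  moreover have "b = cinner v b *s v"
  proof -
    have "cinner a u *s b = cinner a u *s (cinner v b *s v)"
      using b by (simp add: cnj_cinner mult.commute flip: k)
    then show ?thesis
      using nz(2) by (metis cnj_cinner complex_cnj_zero_iff vector_mul_lcancel)
  qed
  ultimately have "outer a b = cscale (cinner u a * cinner b v) (outer u v)"
    by (metis cnj_cinner outer_smult)
  then show ?thesis
    by (simp add: W k[symmetric] cscale_outer mult.commute)
qed

text \<open>The extra factor \<open>norm (outer a b)\<close> avoids a division and lets the norms be
  regrouped into those of \<open>p ** outer a b\<close> and \<open>outer a b ** q\<close>, each
  linear in the distance to \<open>\<nu> *\<^sub>R Y\<close>. The constant depends on none of
  \<open>Y\<close>, \<open>a\<close>, \<open>b\<close>, \<nu>.\<close>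

lemma tproj_defect_bound:
  obtains K where "K \<ge> 0" "\<And>(Y :: complex^'n^'n) a b \<nu>. Y \<in> rank1 \<Longrightarrow>
    norm (tproj Y (outer a b) - outer a b) * norm (outer a b) \<le> K * (norm (outer a b - \<nu> *\<^sub>R Y))\<^sup>2"
proof -
  obtain B where B: "B > 0" "\<And>(M :: complex^'n^'n) N :: complex^'n^'n. norm (M ** N) \<le> norm M * norm N * B"
    using bounded_bilinear.pos_bounded[OF bounded_bilinear_matrix_matrix] by metis
  \<comment> \<open>Since \<open>outer u u\<close> has norm 1, \<open>norm (mat 1) + 1\<close>
    bounds both complementary projections; \<open>B\<close> is the constant of matrix
    multiplication.\<close>
  define K where "K = (norm (mat 1 :: complex^'n^'n) + 1) * B"
  have "norm (tproj Y (outer a b) - outer a b) * norm (outer a b)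
      \<le> K\<^sup>2 * (norm (outer a b - \<nu> *\<^sub>R Y))\<^sup>2"
    if "Y \<in> rank1" for Y :: "complex^'n^'n" and a b \<nu>
  proof -
    obtain \<sigma> u v where Y: "\<sigma> \<noteq> 0" "norm u = 1" "norm v = 1" "Y = cscale \<sigma> (outer u v)"
      using rank1_decomp[OF \<open>Y \<in> rank1\<close>] .
    define k where "k = complex_of_real \<nu> * \<sigma>"
    define p where "p = mat 1 - outer u u"
    define q where "q = mat 1 - outer v v"
    define D where "D = outer a b - \<nu> *\<^sub>R Y"
    have W: "\<nu> *\<^sub>R Y = outer (k *s u) v"
      by (simp add: Y(4) k_def cscale_cscale cscale_outer flip: cscale_of_real)
    have ct: "ctranspose q = q"
      by (simp add: q_def ctranspose_complement)
    have pu: "p *v u = 0" and qv: "q *v v = 0"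
      using Y by (simp_all add: p_def q_def complement_vector cinner_self)
    have out0: "outer 0 z = 0" "outer z 0 = 0" for z :: "complex^'n"
      by (simp_all add: outer_def vec_eq_iff)
    have np: "norm p \<le> norm (mat 1 :: complex^'n^'n) + 1" and nq: "norm q \<le> norm (mat 1 :: complex^'n^'n) + 1"
      using norm_triangle_ineq4[of "mat 1 :: complex^'n^'n" "outer u u"]
        norm_triangle_ineq4[of "mat 1 :: complex^'n^'n" "outer v v"] Y
      by (simp_all add: p_def q_def norm_outer)
    have "p ** D = outer (p *v a) b"
      unfolding D_def W using pu
      by (simp add: bounded_bilinear.diff_right[OF bounded_bilinear_matrix_matrix] matrix_outer
          vector_scalar_commute out0)
    then have "norm (p *v a) * norm b \<le> norm p * norm D * B"
      by (metis B(2) norm_outer)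
    also have "\<dots> \<le> K * norm D"
      using mult_right_mono[OF np, of "norm D * B"] B(1) by (simp add: K_def mult_ac)
    finally have 1: "norm (p *v a) * norm b \<le> K * norm D" .
    have "D ** q = outer a (q *v b)"
      unfolding D_def W using qv
      by (simp add: bounded_bilinear.diff_left[OF bounded_bilinear_matrix_matrix] outer_matrix ct out0)
    then have "norm a * norm (q *v b) \<le> norm D * norm q * B"
      by (metis B(2) norm_outer)
    also have "\<dots> \<le> K * norm D"
      using mult_right_mono[OF nq, of "norm D * B"] B(1) by (simp add: K_def mult_ac)
    finally have 2: "norm a * norm (q *v b) \<le> K * norm D" .
    have "tproj Y (outer a b) - outer a b = - outer (p *v a) (q *v b)"
      by (simp add: tproj_eq[OF Y] matrix_outer outer_matrix ct flip: p_def q_def)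
    then have "norm (tproj Y (outer a b) - outer a b) * norm (outer a b)
        = (norm (p *v a) * norm b) * (norm a * norm (q *v b))"
      by (simp add: norm_outer)
    also have "\<dots> \<le> (K * norm D) * (K * norm D)"
      by (rule mult_mono'[OF 1 2]) auto
    finally show ?thesis
      by (simp add: D_def power2_eq_square mult_ac)
  qed
  then show ?thesis
    using that[of "K\<^sup>2"] by simp
qed

subsection \<open>The gradient near a simple eigenvalue\<close>

lemma wirtinger_bar_differentiable:
  assumes "smooth f"
  shows "wirtinger_bar (\<lambda>z. f (z, cnj z)) differentiable at z"
proof -
  have Ck: "Ck (Suc (Suc 0)) f"
    using assms by (simp only: smooth_def)
  let ?i = "\<lambda>z. (z, cnj z)"
  have i: "(?i has_derivative ?i) (at z)" for z
    by (intro bounded_linear_imp_has_derivative bounded_linear_Pair bounded_linear_ident bounded_linear_cnj)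
  have F: "((\<lambda>z. f (?i z)) has_derivative (\<lambda>h. frechet_derivative f (at (?i z)) (?i h))) (at z)" for z
    using Ck by (intro has_derivative_compose[OF i]) (simp flip: frechet_derivative_works)
  \<comment> \<open>By the chain rule the directions 1 and \<open>\<i>\<close> become
    \<open>(1, 1)\<close> and \<open>(\<i>, - \<i>)\<close>; derivatives of \<open>f\<close> in
    fixed directions are again differentiable.\<close>
  have "wirtinger_bar (\<lambda>z. f (?i z)) = (\<lambda>z. (frechet_derivative f (at (?i z)) (1, 1) +
      \<i> * frechet_derivative f (at (?i z)) (\<i>, - \<i>)) / 2)"
    by (simp add: wirtinger_bar_def fun_eq_iff frechet_derivative_at[OF F, symmetric])
  moreover have "(\<lambda>z. frechet_derivative f (at (?i z)) h) differentiable at z" for h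
  proof -
    have "(\<lambda>p. frechet_derivative f (at p) h) differentiable at (?i z)"
      using Ck by (simp del: split_paired_All)
    then show ?thesis
      using i[of z] differentiable_chain_at[of ?i z] unfolding o_def differentiable_def by blast
  qed
  ultimately show ?thesis
    by simp
qed

lemma grad_eq:
  fixes w v :: "complex^'n"
  assumes M: "M = A + \<epsilon> *\<^sub>R E" "l = lam M"
    and w: "w \<noteq> 0" "ctranspose M *v w = cnj l *s w"
      "\<And>u. ctranspose M *v u = cnj l *s u \<Longrightarrow> \<exists>c. u = c *s w"
    and v: "v \<noteq> 0" "M *v v = l *s v" "\<And>u. M *v u = l *s u \<Longrightarrow> \<exists>c. u = c *s v"
    and wv: "cinner w v \<noteq> 0"
  shows "grad A \<epsilon> f lam E = cscale (2 * wirtinger_bar (\<lambda>z. f (z, cnj z)) l)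
    (cscale (sgn (cinner w v)) (outer (sgn w) (sgn v)))"
  unfolding grad_def Let_def M(1)[symmetric] M(2)[symmetric]
  using outer_eigpair[OF w v wv] by (intro the_equality) metis+

lemma lip_at_grad:
  fixes A Estar :: "complex^'n^'n"
  assumes "smooth f" and ev: "\<And>M. eigval M (lam M)"
    and simple: "simple_eigval (A + \<epsilon> *\<^sub>R Estar) (lam (A + \<epsilon> *\<^sub>R Estar))"
    and cont: "((\<lambda>E. lam (A + \<epsilon> *\<^sub>R E)) \<longlongrightarrow> lam (A + \<epsilon> *\<^sub>R Estar)) (nhds Estar)"
  shows "lip_at Estar (grad A \<epsilon> f lam)"
    and "\<forall>\<^sub>F E in nhds Estar. \<exists>a b. grad A \<epsilon> f lam E = outer a b"
proof -
  define M where "M = (\<lambda>E. A + \<epsilon> *\<^sub>R E)"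
  define l where "l = (\<lambda>E. lam (M E))"
  have M: "lip_at Estar M"
    unfolding lip_at_def M_def by (intro exI[of _ "\<bar>\<epsilon>\<bar>"]) (simp flip: scaleR_diff_right)
  have l: "(l \<longlongrightarrow> l Estar) (nhds Estar)"
    using cont by (simp add: l_def M_def)
  obtain x y where xy: "ctranspose (M Estar) *v x = cnj (l Estar) *s x"
    "M Estar *v y = l Estar *s y" "cinner x y \<noteq> 0"
    "\<And>z. bordered (M Estar) (l Estar) x y *v z = 0 \<Longrightarrow> z = 0"
    "\<And>z. bordered (ctranspose (M Estar)) (cnj (l Estar)) y x *v z = 0 \<Longrightarrow> z = 0"
    using simple_eigval_eigvecs[of "M Estar" "l Estar"] simple unfolding M_def l_def by blast
  have evl: "eigval (M E) (l E)" for E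
    by (simp add: l_def ev)
  obtain v where v: "lip_at Estar l" "lip_at Estar v"
    "\<forall>\<^sub>F E in nhds Estar. v E \<noteq> 0 \<and> M E *v v E = l E *s v E \<and>
      (\<forall>u. M E *v u = l E *s u \<longrightarrow> (\<exists>c. u = c *s v E))"
    using lip_at_eigenvector[OF M l xy(1,4) evl] by blast
  have M': "lip_at Estar (\<lambda>E. ctranspose (M E))"
    using bounded_linear_ctranspose M by (rule lip_at_linear)
  have l': "((\<lambda>E. cnj (l E)) \<longlongrightarrow> cnj (l Estar)) (nhds Estar)"
    using l by (rule tendsto_cnj)
  \<comment> \<open>For the adjoint the roles of \<open>x\<close> and \<open>y\<close> are
    exchanged, so \<open>w\<close> is scaled against \<open>y\<close> as \<open>v\<close> was
    against \<open>x\<close>.\<close>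
  obtain w where w: "lip_at Estar w"
    "\<forall>\<^sub>F E in nhds Estar. w E \<noteq> 0 \<and> ctranspose (M E) *v w E = cnj (l E) *s w E \<and>
      (\<forall>u. ctranspose (M E) *v u = cnj (l E) *s u \<longrightarrow> (\<exists>c. u = c *s w E))"
  proof (rule lip_at_eigenvector[OF M' l', of y x])
    show "ctranspose (ctranspose (M Estar)) *v y = cnj (cnj (l Estar)) *s y"
      by (simp add: xy(2))
  qed (use xy(5) eigval_ctranspose[OF evl] in blast)+
  let ?wv = "\<lambda>E. cinner (w E) (v E)"
  have wv: "lip_at Estar ?wv"
    using bounded_bilinear_cinner w(1) v(2) by (rule lip_at_bilinear)
  \<comment> \<open>The eigenspaces at \<open>Estar\<close> are lines, so
    \<open>cinner x y \<noteq> 0\<close> passes to the chosen eigenvectors and persists nearby by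
    continuity.\<close>
  obtain c c' where "x = c *s w Estar" "y = c' *s v Estar"
    using xy eventually_nhds_x_imp_x[OF v(3)] eventually_nhds_x_imp_x[OF w(2)] by blast
  then have wv0: "?wv Estar \<noteq> 0"
    using xy(3) by auto
  then have "\<forall>\<^sub>F E in nhds Estar. ?wv E \<noteq> 0"
    using lip_at_tendsto[OF wv] by (rule tendsto_imp_eventually_ne[rotated])
  with v(3) w(2) have eq: "\<forall>\<^sub>F E in nhds Estar. grad A \<epsilon> f lam E =
      cscale (2 * wirtinger_bar (\<lambda>z. f (z, cnj z)) (l E)) (cscale (sgn (?wv E)) (outer (sgn (w E)) (sgn (v E))))"
  proof eventually_elim
    case (elim E)
    then show ?case
      by (intro grad_eq[of "M E"]) (simp_all add: M_def l_def)
  qed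
  then show "\<forall>\<^sub>F E in nhds Estar. \<exists>a b. grad A \<epsilon> f lam E = outer a b"
    by eventually_elim (auto simp: cscale_outer)
  have "w Estar \<noteq> 0" "v Estar \<noteq> 0"
    using wv0 by auto
  then have "lip_at Estar (\<lambda>E. sgn (w E))" "lip_at Estar (\<lambda>E. sgn (v E))" "lip_at Estar (\<lambda>E. sgn (?wv E))"
    using wv0 w(1) v(2) wv by (auto intro: lip_at_compose lip_at_sgn)
  moreover have "lip_at Estar (\<lambda>E. 2 * wirtinger_bar (\<lambda>z. f (z, cnj z)) (l E))"
    by (intro lip_at_bilinear[OF bounded_bilinear_mult] lip_at_const lip_at_compose[OF _ v(1)]
        differentiable_imp_lip_at wirtinger_bar_differentiable assms(1))
  ultimately show "lip_at Estar (grad A \<epsilon> f lam)"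
    by (intro lip_at_cong[OF eq] lip_at_bilinear[OF bounded_bilinear_cscale]
        lip_at_bilinear[OF bounded_bilinear_outer])
qed

text \<open>The residuals of both projections are orthogonal to the difference of the projected
  matrices. Hence the radius \<delta> around \<open>Ystar\<close> carries over to
  \<open>Estar\<close> unchanged.\<close>

lemma norm_orth_proj_diff_le:
  assumes "subspace S"
  shows "norm (orth_proj S Y - orth_proj S Z) \<le> norm (Y - Z)"
proof -
  obtain E where E: "E \<in> S" "\<forall>X\<in>S. Re (finner (Y - E) X) = 0"
    using orth_proj_exists[OF assms] by blast
  obtain F where F: "F \<in> S" "\<forall>X\<in>S. Re (finner (Z - F) X) = 0"
    using orth_proj_exists[OF assms] by blast
  have "E - F \<in> S"
    using assms E F by (simp add: subspace_diff)
  then have "(Y - E) \<bullet> (E - F) = 0" "(Z - F) \<bullet> (E - F) = 0"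
    using E F by (simp_all flip: Re_finner_eq_inner)
  then have "(E - F) \<bullet> (E - F) = (Y - Z) \<bullet> (E - F)"
    by (simp add: inner_diff_left)
  then have "norm (E - F) * norm (E - F) \<le> norm (Y - Z) * norm (E - F)"
    by (metis norm_cauchy_schwarz power2_norm_eq_inner power2_eq_square)
  then have "norm (E - F) \<le> norm (Y - Z)"
    by (cases "E = F") auto
  moreover have "orth_proj S Y = E" "orth_proj S Z = F"
    using E F assms by (auto intro: orth_proj_eqI)
  ultimately show ?thesis
    by simp
qed

subsection \<open>Quadratic smallness of the defect\<close>

theorem lemma4p5:
  fixes A :: "complex^'n^'n" and \<epsilon> :: real and S :: "(complex^'n^'n) set"
    and f :: "complex \<times> complex \<Rightarrow> complex" and lam :: "complex^'n^'n \<Rightarrow> complex"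
    and Ystar Estar :: "complex^'n^'n"
  assumes "\<epsilon> > 0"
    and "subspace S"
    and "smooth f"
    and "\<And>z. f (z, cnj z) = f (cnj z, z) \<and> f (z, cnj z) \<in> \<real>"
    and "\<And>M. eigval M (lam M)"
    and "Ystar \<in> rank1"
    and "Estar = orth_proj S Ystar"
    and "norm Estar = 1"
    and "simple_eigval (A + \<epsilon> *\<^sub>R Estar) (lam (A + \<epsilon> *\<^sub>R Estar))"
    and "\<exists>r>0. continuous_on (ball Estar r) (\<lambda>E. lam (A + \<epsilon> *\<^sub>R E))"
    and "rank1_rhs S A \<epsilon> f lam Ystar = 0"
    and nondegenerate: "tproj Ystar (grad A \<epsilon> f lam Estar) \<noteq> 0"
  shows "\<exists>\<delta>bar>0. \<exists>C. \<forall>\<delta>. 0 < \<delta> \<and> \<delta> \<le> \<delta>bar \<longrightarrow>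
           (\<forall>Y\<in>rank1. norm (Y - Ystar) \<le> \<delta> \<and> norm (orth_proj S Y) = 1 \<longrightarrow>
              norm (tproj Y (grad A \<epsilon> f lam (orth_proj S Y)) - grad A \<epsilon> f lam (orth_proj S Y))
                \<le> C * \<delta>\<^sup>2)"
proof -
  define G where "G = grad A \<epsilon> f lam"
  obtain r where r: "r > 0" "continuous_on (ball Estar r) (\<lambda>E. lam (A + \<epsilon> *\<^sub>R E))"
    using assms(10) by blast
  then have "isCont (\<lambda>E. lam (A + \<epsilon> *\<^sub>R E)) Estar"
    by (simp add: continuous_on_eq_continuous_at)
  then have cont: "((\<lambda>E. lam (A + \<epsilon> *\<^sub>R E)) \<longlongrightarrow> lam (A + \<epsilon> *\<^sub>R Estar)) (nhds Estar)"
    unfolding isCont_def by (simp add: tendsto_at_iff_tendsto_nhds[where g = "\<lambda>E. lam (A + \<epsilon> *\<^sub>R E)"])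
  have G_lip: "lip_at Estar G" and G_outer: "\<forall>\<^sub>F E in nhds Estar. \<exists>a b. G E = outer a b"
    unfolding G_def using lip_at_grad[OF assms(3,5,9) cont] by blast+
  \<comment> \<open>This is the coefficient of \<open>Y\<close> in the differential equation at
    \<open>Ystar\<close>; stationarity equates the projected gradient with \<nu> times
    \<open>Ystar\<close>.\<close>
  define \<nu> where "\<nu> = Re (finner (tproj Ystar (G Estar)) Estar)"
  have "tproj Ystar (G Estar) = \<nu> *\<^sub>R Ystar"
    using assms(11) by (simp add: rank1_rhs_def Let_def \<nu>_def G_def flip: assms(7))
  moreover obtain a b where "G Estar = outer a b"
    using eventually_nhds_x_imp_x[OF G_outer] by blast
  ultimately have Gs: "G Estar = \<nu> *\<^sub>R Ystar"
    using tproj_fixed_multiple[of Ystar a b \<nu>] assms(6) nondegenerate by (simp add: G_def)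
  have "G Estar \<noteq> 0"
    using nondegenerate \<open>tproj Ystar (G Estar) = \<nu> *\<^sub>R Ystar\<close> by (simp add: Gs[symmetric] G_def)
  \<comment> \<open>Half of the norm at \<open>Estar\<close> remains a lower bound for
    \<open>norm (G E)\<close> nearby.\<close>
  define g where "g = norm (G Estar) / 2"
  have g: "g > 0" "g < norm (G Estar)"
    using \<open>G Estar \<noteq> 0\<close> by (simp_all add: g_def)
  obtain L where L: "L > 0" "\<forall>\<^sub>F E in nhds Estar. norm (G E - G Estar) \<le> L * norm (E - Estar)"
    using lip_atE[OF G_lip] .
  have "\<forall>\<^sub>F E in nhds Estar. g < norm (G E)"
    using tendsto_norm[OF lip_at_tendsto[OF G_lip]] g(2) by (rule order_tendstoD)
  with G_outer L(2) have "\<forall>\<^sub>F E in nhds Estar. (\<exists>a b. G E = outer a b) \<and>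
      norm (G E - G Estar) \<le> L * norm (E - Estar) \<and> g < norm (G E)"
    by eventually_elim blast
  then obtain d where d: "d > 0" "\<And>E. dist E Estar < d \<Longrightarrow> (\<exists>a b. G E = outer a b) \<and>
      norm (G E - G Estar) \<le> L * norm (E - Estar) \<and> g < norm (G E)"
    unfolding eventually_nhds_metric by blast
  obtain K where K: "K \<ge> 0" "\<And>(Y :: complex^'n^'n) a b \<nu>. Y \<in> rank1 \<Longrightarrow>
    norm (tproj Y (outer a b) - outer a b) * norm (outer a b) \<le> K * (norm (outer a b - \<nu> *\<^sub>R Y))\<^sup>2"
    using tproj_defect_bound by blast
  \<comment> \<open>The radius \<open>d / 2\<close> turns the bound by \<delta> into the strict
    inequality \<open>dist E Estar < d\<close>.\<close>
  have "norm (tproj Y (G (orth_proj S Y)) - G (orth_proj S Y)) \<le> (K * (L + \<bar>\<nu>\<bar>)\<^sup>2 / g) * \<delta>\<^sup>2"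
    if \<delta>: "0 < \<delta>" "\<delta> \<le> d / 2" and Y: "Y \<in> rank1" "norm (Y - Ystar) \<le> \<delta>" for \<delta> Y
  proof -
    define E where "E = orth_proj S Y"
    have E: "norm (E - Estar) \<le> \<delta>"
      using norm_orth_proj_diff_le[OF assms(2), of Y Ystar] Y(2) by (simp add: E_def assms(7))
    then have "dist E Estar < d"
      using \<delta> d(1) by (simp add: dist_norm)
    then obtain a b where GE: "G E = outer a b" "norm (G E - G Estar) \<le> L * norm (E - Estar)" "g < norm (G E)"
      using d(2) by blast
    \<comment> \<open>The multiplier \<nu> stays frozen at its stationary value, so the Lipschitz
      bound for \<open>G\<close> and the distance from \<open>Y\<close> to \<open>Ystar\<close>
      account for the whole error.\<close>
    have "G E - \<nu> *\<^sub>R Y = (G E - G Estar) - \<nu> *\<^sub>R (Y - Ystar)"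
      by (simp add: Gs algebra_simps)
    then have "norm (G E - \<nu> *\<^sub>R Y) \<le> norm (G E - G Estar) + \<bar>\<nu>\<bar> * norm (Y - Ystar)"
      by (metis norm_scaleR norm_triangle_ineq4)
    also have "\<dots> \<le> L * \<delta> + \<bar>\<nu>\<bar> * \<delta>"
      using GE(2) E L(1) Y(2) by (intro add_mono mult_left_mono order_trans[OF GE(2)]) auto
    finally have D: "norm (G E - \<nu> *\<^sub>R Y) \<le> (L + \<bar>\<nu>\<bar>) * \<delta>"
      by (simp add: algebra_simps)
    have "norm (tproj Y (G E) - G E) * g \<le> norm (tproj Y (G E) - G E) * norm (G E)"
      using GE(3) by (intro mult_left_mono) auto
    also have "\<dots> \<le> K * (norm (G E - \<nu> *\<^sub>R Y))\<^sup>2"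
      using K(2)[OF Y(1)] GE(1) by simp
    also have "\<dots> \<le> K * ((L + \<bar>\<nu>\<bar>) * \<delta>)\<^sup>2"
      using D K(1) by (intro mult_left_mono power_mono) auto
    also have "\<dots> = (K * (L + \<bar>\<nu>\<bar>)\<^sup>2) * \<delta>\<^sup>2"
      by (simp only: power_mult_distrib mult.assoc)
    finally show ?thesis
      using g(1) by (simp add: E_def[symmetric] pos_le_divide_eq)
  qed
  then show ?thesis
    using d(1) unfolding G_def by (intro exI[of _ "d / 2"] conjI exI[of _ "K * (L + \<bar>\<nu>\<bar>)\<^sup>2 / g"]) auto
qed

end
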